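(* Let $\mathbb{F}$ be an arbitrary field and let $\mathbf{O}=\mathbf{O}(\mathbb{F})$ be the split-octonion algebra over $\mathbb{F}$. Assume that $f(y)\in\mathbb{F}[y]$ is a non-zero polynomial of degree $n\geqslant1$ without constant term, and let $c\in\mathbf{O}\setminus\mathbb{F}1_{\mathbf{O}}$. Denote by $X\subseteq\mathbf{O}$ the set of all solutions $x\in\mathbf{O}$ of the equation $f(x)=c$. Then $$|X|\leqslant n^2.$$
   Context: $\mathbb{F}$ is a field (possibly finite) of arbitrary characteristic. The split-octonion algebra $\mathbf{O}=\mathbf{O}(\mathbb{F})$ is the $8$-dimensional vector space of all matrices $a=\begin{pmatrix}\alpha&\mathbf{u}\\ \mathbf{v}&\beta\end{pmatrix}$ with $\alpha,\beta\in\mathbb{F}$ and vectors $\mathbf{u},\mathbf{v}\in\mathbb{F}^3$, with multiplication $$aa'=\begin{pmatrix}\alpha\alpha'+\mathbf{u}\cdot\mathbf{v}'&\alpha\mathbf{u}'+\beta'\mathbf{u}-\mathbf{v}\times\mathbf{v}'\\ \alpha'\mathbf{v}+\beta\mathbf{v}'+\mathbf{u}\times\mathbf{u}'&\beta\beta'+\mathbf{v}\cdot\mathbf{u}'\end{pmatrix},\qquad a'=\begin{pmatrix}\alpha'&\mathbf{u}'\\ \mathbf{v}'&\beta'\end{pmatrix},$$ where $\cdot$ and $\times$ are the usual dot and cross products on $\mathbb{F}^3$. The unity $1_{\mathbf{O}}$ is the element with $\alpha=\beta=1$, $\mathbf{u}=\mathbf{v}=\mathbf{0}$. The algebra is alternative,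 hence power-associative, so powers $x^k$ are well defined; for $f(y)=\alpha_ny^n+\cdots+\alpha_1y$ put $f(x)=\alpha_nx^n+\cdots+\alpha_1x\in\mathbf{O}$. *)

theory Defs
  imports "HOL-Analysis.Analysis" "HOL-Computational_Algebra.Polynomial"
begin

text \<open>
  The library's inner product and \<^const>\<open>cross3\<close> exist over the reals only; these are their
  analogues over an arbitrary commutative ring.
\<close>

definition dot3 :: "'a::comm_ring_1 ^ 3 \<Rightarrow> 'a ^ 3 \<Rightarrow> 'a" where
  "dot3 u v = (\<Sum>i\<in>UNIV. u $ i * v $ i)"

definition cross_prod :: "'a::comm_ring_1 ^ 3 \<Rightarrow> 'a ^ 3 \<Rightarrow> 'a ^ 3" where
  "cross_prod u v =
     vector [u $ 2 * v $ 3 - u $ 3 * v $ 2,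
             u $ 3 * v $ 1 - u $ 1 * v $ 3,
             u $ 1 * v $ 2 - u $ 2 * v $ 1]"

lemma dot3_eq_inner: "dot3 u v = u \<bullet> v"
  by (simp add: dot3_def inner_vec_def)

lemma cross_prod_eq_cross3: "cross_prod u v = cross3 u v"
  by (simp add: cross_prod_def cross3_def)

text \<open>\<open>Oct \<alpha> u v \<beta>\<close> is the matrix with rows \<open>(\<alpha>, u)\<close> and \<open>(v, \<beta>)\<close>.\<close>

datatype 'a octonion =
  Oct (oct_a: 'a) (oct_u: "'a ^ 3") (oct_v: "'a ^ 3") (oct_b: 'a)

instantiation octonion :: (field) ab_group_add
begin

definition zero_octonion :: "'a octonion" where
  "0 = Oct 0 0 0 0"

definition plus_octonion :: "'a octonion \<Rightarrow> 'a octonion \<Rightarrow> 'a octonion" where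
  "x + y = Oct (oct_a x + oct_a y) (oct_u x + oct_u y) (oct_v x + oct_v y) (oct_b x + oct_b y)"

definition uminus_octonion :: "'a octonion \<Rightarrow> 'a octonion" where
  "- x = Oct (- oct_a x) (- oct_u x) (- oct_v x) (- oct_b x)"

definition minus_octonion :: "'a octonion \<Rightarrow> 'a octonion \<Rightarrow> 'a octonion" where
  "x - y = Oct (oct_a x - oct_a y) (oct_u x - oct_u y) (oct_v x - oct_v y) (oct_b x - oct_b y)"

instance
  by standard
    (simp_all add: zero_octonion_def plus_octonion_def uminus_octonion_def minus_octonion_def
       algebra_simps)

end

text \<open>
  With \<open>1\<close> and \<open>*\<close> in place, \<open>x ^ k\<close> is the library's \<^const>\<open>power\<close>, that is
  \<open>x ^ 0 = 1\<close> and \<open>x ^ Suc k = x * x ^ k\<close>. The multiplication is not associative, so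
  the type is not an instance of \<^class>\<open>monoid_mult\<close>; but it is alternative (see below).
\<close>

instantiation octonion :: (field) "{one, times}"
begin

definition one_octonion :: "'a octonion" where
  "1 = Oct 1 0 0 1"

definition times_octonion :: "'a octonion \<Rightarrow> 'a octonion \<Rightarrow> 'a octonion" where
  "x * y = Oct
     (oct_a x * oct_a y + dot3 (oct_u x) (oct_v y))
     (oct_a x *s oct_u y + oct_b y *s oct_u x - cross_prod (oct_v x) (oct_v y))
     (oct_a y *s oct_v x + oct_b x *s oct_v y + cross_prod (oct_u x) (oct_u y))
     (oct_b x * oct_b y + dot3 (oct_v x) (oct_u y))"

instance ..

end

instance octonion :: (field) power ..

definition oct_scale :: "'a::field \<Rightarrow> 'a octonion \<Rightarrow> 'a octonion" where
  "oct_scale r x = Oct (r * oct_a x) (r *s oct_u x) (r *s oct_v x) (r * oct_b x)"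

definition oct_scalars :: "'a::field octonion set" where
  "oct_scalars = range (\<lambda>r. oct_scale r 1)"

text \<open>
  Evaluation at an octonion of a polynomial without constant term; the coefficient of
  degree \<open>0\<close> is not used.
\<close>

definition oct_eval :: "'a::field poly \<Rightarrow> 'a octonion \<Rightarrow> 'a octonion" where
  "oct_eval f x = (\<Sum>k = 1..degree f. oct_scale (coeff f k) (x ^ k))"

lemmas octonion_arith_defs =
  zero_octonion_def plus_octonion_def uminus_octonion_def minus_octonion_def
  one_octonion_def times_octonion_def oct_scale_def

lemma vector_space_octonion: "vector_space (oct_scale :: 'a::field \<Rightarrow> _)"
  by standard (simp_all add: octonion_arith_defs vec_eq_iff algebra_simps)

lemma octonion_one_left: "1 * x = (x :: 'a::field octonion)"
  and octonion_one_right: "x * 1 = (x :: 'a::field octonion)"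
  by (cases x; simp add: octonion_arith_defs dot3_def cross_prod_def vec_eq_iff forall_3)+

lemma octonion_left_alternative: "x * (x * y) = (x * x) * (y :: 'a::field octonion)"
  and octonion_right_alternative: "(y * x) * x = y * (x * (x :: 'a::field octonion))"
  by (simp_all add: octonion_arith_defs dot3_def cross_prod_def vec_eq_iff forall_3 sum_3
      algebra_simps)

end

theory Submission
  imports "HOL-Algebra.Algebraic_Closure_Type" Defs
begin

text \<open>
  Every octonion satisfies its own quadratic equation \<open>x\<^sup>2 = T x - N\<close>, so \<open>f x\<close> is a combination
  \<open>A + B x\<close>. If \<open>f x = c\<close> is not a scalar then \<open>B \<noteq> 0\<close>, hence \<open>x = r + s c\<close> lies in the plane
  spanned by \<open>1\<close> and \<open>c\<close>, a commutative algebra isomorphic to \<open>F[z] / (p)\<close> with \<open>p\<close> the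
  characteristic polynomial of \<open>c\<close>. The equation thus says that \<open>p\<close> divides \<open>f (r + s z) - z\<close>.
  Let \<open>l\<close> and \<open>m\<close> be the roots of \<open>p\<close> in the algebraic closure. If they differ, the pair \<open>(r, s)\<close>
  is determined by \<open>r + s l\<close> and \<open>r + s m\<close>, which are roots of \<open>f - l\<close> and \<open>f - m\<close>. If \<open>l = m\<close>,
  it is determined by \<open>r + s l\<close> alone, because taking derivatives at \<open>l\<close> gives
  \<open>s f'(r + s l) = 1\<close>.
\<close>

definition oct_trace :: "'a::field octonion \<Rightarrow> 'a" where
  "oct_trace x = oct_a x + oct_b x"

definition oct_norm :: "'a::field octonion \<Rightarrow> 'a" where
  "oct_norm x = oct_a x * oct_b x - dot3 (oct_u x) (oct_v x)"

definition oct_plane :: "'a::field octonion \<Rightarrow> 'a \<Rightarrow> 'a \<Rightarrow> 'a octonion" where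
  "oct_plane c r s = oct_scale r 1 + oct_scale s c"

interpretation oct: vector_space "oct_scale :: 'a::field \<Rightarrow> _"
  by (rule vector_space_octonion)

text \<open>Since \<open>c\<close> is a root of \<open>z^2 - oct_trace c * z + oct_norm c\<close>,
  the plane multiplies like linear polynomials modulo this quadratic.\<close>

lemma oct_plane_mult:
  "oct_plane c r s * oct_plane c a b =
    oct_plane c (r * a - oct_norm c * (s * b)) (r * b + s * a + oct_trace c * (s * b))"
  by (simp add: oct_plane_def oct_norm_def oct_trace_def octonion_arith_defs dot3_def
      cross_prod_def vec_eq_iff forall_3 sum_3 algebra_simps)

lemma oct_plane_sum:
  "(\<Sum>k\<in>I. oct_scale (e k) (oct_plane c (a k) (b k))) =
    oct_plane c (\<Sum>k\<in>I. e k * a k) (\<Sum>k\<in>I. e k * b k)"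
  by (simp add: oct_plane_def oct.scale_right_distrib sum.distrib oct.scale_sum_left)

lemma oct_plane_inject:
  assumes "c \<notin> oct_scalars"
  shows "oct_plane c r s = oct_plane c r' s' \<longleftrightarrow> r = r' \<and> s = s'"
proof
  assume eq: "oct_plane c r s = oct_plane c r' s'"
  then have *: "oct_scale (s - s') c = oct_scale (r' - r) 1"
    by (simp add: oct_plane_def oct.scale_left_diff_distrib algebra_simps)
  have "s = s'"
  proof (rule ccontr)
    assume "s \<noteq> s'"
    then have "c = oct_scale (inverse (s - s')) (oct_scale (s - s') c)"
      by simp
    also have "\<dots> = oct_scale (inverse (s - s') * (r' - r)) 1"
      by (simp add: *)
    finally show False
      using assms by (auto simp: oct_scalars_def)
  qed
  moreover from this * have "r' - r = 0"
    by (simp add: oct.scale_left_diff_distrib octonion_arith_defs)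
  ultimately show "r = r' \<and> s = s'"
    by simp
qed simp

text \<open>The octonion power and the reduced power of \<open>r + s z\<close> obey the same
  recursion. The roots \<open>l\<close> and \<open>m\<close> may exist only in the closure, hence
  \<open>to_ac\<close>, but the remainder keeps coefficients \<open>a\<close>, \<open>b\<close> in
  the base field.\<close>

lemma oct_plane_power:
  fixes c :: "'a::field octonion"
  assumes tr: "l + m = to_ac (oct_trace c)" and nm: "l * m = to_ac (oct_norm c)"
  shows "\<exists>a b. oct_plane c r s ^ k = oct_plane c a b \<and>
    [:-l, 1:] * [:-m, 1:] dvd [:to_ac r, to_ac s:] ^ k - [:to_ac a, to_ac b:]"
proof (induction k)
  case 0
  show ?case
    by (rule exI[of _ 1], rule exI[of _ 0])
      (simp add: oct_plane_def octonion_arith_defs one_pCons)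
next
  case (Suc k)
  let ?p = "[:-l, 1:] * [:-m, 1:]" and ?x = "[:to_ac r, to_ac s:]"
  obtain a b where pow: "oct_plane c r s ^ k = oct_plane c a b"
    and dvd: "?p dvd ?x ^ k - [:to_ac a, to_ac b:]"
    using Suc.IH by blast
  define a' where "a' = r * a - oct_norm c * (s * b)"
  define b' where "b' = r * b + s * a + oct_trace c * (s * b)"
  \<comment> \<open>The product has leading term \<open>s * b * z^2\<close>, so one subtraction of
    that multiple of \<open>?p\<close> completes the reduction.\<close>
  have eq: "?x * [:to_ac a, to_ac b:] - [:to_ac a', to_ac b':] = smult (to_ac (s * b)) ?p"
    by (simp add: a'_def b'_def tr[symmetric] nm[symmetric] algebra_simps)
  have "?x ^ Suc k - [:to_ac a', to_ac b':] =
      ?x * (?x ^ k - [:to_ac a, to_ac b:]) + smult (to_ac (s * b)) ?p"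
    by (simp only: power_Suc right_diff_distrib eq[symmetric] diff_add_eq add_diff_eq
        add_diff_cancel_right')
  then have "?p dvd ?x ^ Suc k - [:to_ac a', to_ac b':]"
    using dvd by (simp only: dvd_add dvd_mult dvd_smult dvd_refl)
  moreover have "oct_plane c r s ^ Suc k = oct_plane c a' b'"
    by (simp add: pow oct_plane_mult a'_def b'_def)
  ultimately show ?case by blast
qed

lemma pcompose_as_sum:
  fixes p q :: "'a::comm_ring_1 poly"
  shows "pcompose p q = (\<Sum>k\<le>degree p. smult (coeff p k) (q ^ k))"
proof -
  have "degree (map_poly (\<lambda>x. [:x:]) p) = degree p"
    by (rule degree_map_poly) simp
  then show ?thesis
    by (simp add: pcompose_altdef poly_altdef coeff_map_poly)
qed

lemma oct_eval_plane:
  fixes f :: "'a::field poly"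
  assumes f0: "coeff f 0 = 0"
    and tr: "l + m = to_ac (oct_trace c)" and nm: "l * m = to_ac (oct_norm c)"
  shows "\<exists>A B. oct_eval f (oct_plane c r s) = oct_plane c A B \<and>
    [:-l, 1:] * [:-m, 1:] dvd
      pcompose (map_poly to_ac f) [:to_ac r, to_ac s:] - [:to_ac A, to_ac B:]"
proof -
  let ?p = "[:-l, 1:] * [:-m, 1:]" and ?x = "[:to_ac r, to_ac s:]"
  obtain a b where pow: "oct_plane c r s ^ k = oct_plane c (a k) (b k)"
    and dvd: "?p dvd ?x ^ k - [:to_ac (a k), to_ac (b k):]" for k
    using oct_plane_power[OF tr nm] by metis
  define I where "I = {1..degree f}"
  define A B where "A = (\<Sum>k\<in>I. coeff f k * a k)" and "B = (\<Sum>k\<in>I. coeff f k * b k)"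
  have "oct_eval f (oct_plane c r s) = oct_plane c A B"
    by (simp add: oct_eval_def pow oct_plane_sum A_def B_def I_def)
  moreover have "pcompose (map_poly to_ac f) ?x = (\<Sum>k\<le>degree f. smult (to_ac (coeff f k)) (?x ^ k))"
    by (simp add: pcompose_as_sum coeff_map_poly degree_map_poly)
  \<comment> \<open>The constant term vanishes, so the sum may start at 1 as in
    \<open>oct_eval\<close>.\<close>
  moreover have "\<dots> = (\<Sum>k\<in>I. smult (to_ac (coeff f k)) (?x ^ k))"
    by (rule sum.mono_neutral_right) (auto simp: I_def f0 Suc_le_eq)
  moreover have "[:to_ac A, to_ac B:] =
      (\<Sum>k\<in>I. smult (to_ac (coeff f k)) [:to_ac (a k), to_ac (b k):])"
    by (intro poly_eqI)
      (auto simp: A_def B_def to_ac_sum coeff_sum coeff_pCons split: nat.splits)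
  moreover have "?p dvd (\<Sum>k\<in>I. smult (to_ac (coeff f k)) (?x ^ k - [:to_ac (a k), to_ac (b k):]))"
    by (intro dvd_sum dvd_smult dvd)
  ultimately show ?thesis
    by (intro exI[of _ A] exI[of _ B]) (simp only: sum_subtractf smult_diff_right simp_thms)
qed

lemma oct_solution_in_plane:
  fixes f :: "'a::field poly"
  assumes f0: "coeff f 0 = 0" and c: "oct_eval f x \<notin> oct_scalars"
  shows "\<exists>r s. x = oct_plane (oct_eval f x) r s"
proof -
  have x: "x = oct_plane x 0 1"
    by (simp add: oct_plane_def)
  obtain a b where pow: "oct_plane x 0 1 ^ k = oct_plane x (a k) (b k)" for k
  proof -
    have "\<exists>a b. oct_plane x 0 1 ^ k = oct_plane x a b" for k
    proof (induction k)
      case 0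
      show ?case
        by (rule exI[of _ 1], rule exI[of _ 0]) (simp add: oct_plane_def octonion_arith_defs)
    next
      case (Suc k)
      then obtain a b where "oct_plane x 0 1 ^ k = oct_plane x a b" by blast
      then show ?case by (simp only: power_Suc oct_plane_mult) blast
    qed
    then show ?thesis using that by metis
  qed
  obtain A B where AB: "oct_eval f x = oct_plane x A B"
    using pow by (simp add: x[symmetric] oct_eval_def oct_plane_sum)
  \<comment> \<open>Otherwise the value would be the scalar \<open>A\<close>; now
    \<open>A + B x\<close> can be solved for \<open>x\<close>.\<close>
  have "B \<noteq> 0"
    using c AB by (auto simp: oct_plane_def oct_scalars_def)
  then have "x = oct_plane (oct_eval f x) (- A / B) (1 / B)"
    unfolding AB by (simp add: oct_plane_def oct.scale_right_distrib flip: add.assoc oct.scale_left_distrib)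
  then show ?thesis by blast
qed

text \<open>Given one root \<open>l\<close> of \<open>z^2 - t z + n\<close>, Vieta's formulas force
  the other to be \<open>t - l\<close>.\<close>

lemma quadratic_roots_exist:
  fixes t n :: "'k::alg_closed_field"
  shows "\<exists>l m. l + m = t \<and> l * m = n"
proof -
  obtain l where "poly [:n, -t, 1:] l = 0"
    using alg_closed_imp_poly_has_root[of "[:n, -t, 1:]"] by auto
  then have "l * (t - l) = n"
    by (simp add: algebra_simps add_eq_0_iff)
  then show ?thesis
    by (intro exI[of _ l] exI[of _ "t - l"]) simp
qed

lemma card_pairs_pcompose_le:
  fixes F :: "'k::field poly" and l m :: 'k
  assumes n: "degree F = n" "n \<ge> 1"
  defines "S \<equiv> {(r, s). [:-l, 1:] * [:-m, 1:] dvd pcompose F [:r, s:] - [:0, 1:]}"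
  shows "finite S \<and> card S \<le> n\<^sup>2"
proof -
  define R where "R y = {x. poly (F - [:y:]) x = 0}" for y
  have deg: "degree (F - [:y:]) = n" for y
    unfolding diff_conv_add_uminus using n by (subst degree_add_eq_left) auto
  have fin: "finite (R y)" and card: "card (R y) \<le> n" for y
  proof -
    have "F - [:y:] \<noteq> 0"
      using deg[of y] n by auto
    then show "finite (R y)" "card (R y) \<le> n"
      unfolding R_def using poly_roots_finite card_poly_roots_bound deg by metis+
  qed
  \<comment> \<open>Evaluating the divisibility at the root \<open>y\<close> of the quadratic gives
    \<open>F (r + s y) = y\<close>.\<close>
  have root: "r + s * y \<in> R y" if "(r, s) \<in> S" "y = l \<or> y = m" for r s y
  proof -
    have "[:-l, 1:] * [:-m, 1:] dvd pcompose F [:r, s:] - [:0, 1:]"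
      using that(1) unfolding S_def by blast
    then have "[:-y, 1:] dvd pcompose F [:r, s:] - [:0, 1:]"
      using that(2) by (auto dest: dvd_mult_left dvd_mult_right simp only:)
    then show ?thesis
      by (simp add: dvd_iff_poly_eq_0 poly_pcompose R_def mult.commute)
  qed
  show ?thesis
  proof (cases "l = m")
    case False
    let ?g = "\<lambda>(r, s). (r + s * l, r + s * m)"
    have "inj_on ?g S"
    proof (rule inj_onI, clarify)
      fix r s r' s'
      assume eq: "r + s * l = r' + s' * l" "r + s * m = r' + s' * m"
      \<comment> \<open>A linear polynomial is determined by its values at two distinct
        points.\<close>
      have "(s - s') * (l - m) =
          (r + s * l - (r' + s' * l)) - (r + s * m - (r' + s' * m))"
        by (simp add: algebra_simps)
      with eq have "(s - s') * (l - m) = 0" by simp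
      with False eq show "r = r' \<and> s = s'" by simp
    qed
    moreover have "?g ` S \<subseteq> R l \<times> R m"
      using root by auto
    ultimately have "finite S" "card S \<le> card (R l \<times> R m)"
      using fin by (meson finite_SigmaI inj_on_finite card_inj_on_le)+
    moreover have "card (R l \<times> R m) \<le> n\<^sup>2"
      using card by (simp add: card_cartesian_product power2_eq_square mult_mono)
    ultimately show ?thesis by simp
  next
    case True
    let ?g = "\<lambda>(r, s). r + s * l"
    \<comment> \<open>A double root is also a root of the derivative, which the chain rule
      computes.\<close>
    have deriv: "s * poly (pderiv F) (r + s * l) = 1" if "(r, s) \<in> S" for r s
    proof -
      have "[:-l, 1:] * [:-l, 1:] dvd pcompose F [:r, s:] - [:0, 1:]"
        using that unfolding S_def True by blast
      then obtain q where "pcompose F [:r, s:] - [:0, 1:] = ([:-l, 1:] * [:-l, 1:]) * q"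
        by (rule dvdE)
      then have "poly (pderiv (pcompose F [:r, s:] - [:0, 1:])) l = 0"
        by (simp only: pderiv_mult poly_add poly_mult) simp
      then show ?thesis
        by (simp add: pderiv_diff pderiv_pcompose poly_pcompose pderiv_pCons mult.commute)
    qed
    have "inj_on ?g S"
    proof (rule inj_onI, clarify)
      fix r s r' s'
      assume S: "(r, s) \<in> S" "(r', s') \<in> S" and eq: "r + s * l = r' + s' * l"
      \<comment> \<open>Both are inverses of the same derivative value.\<close>
      then have "s = s'"
        using deriv[OF S(1)] deriv[OF S(2)] by (metis mult.commute mult.left_commute mult.right_neutral)
      with eq show "r = r' \<and> s = s'" by simp
    qed
    moreover have "?g ` S \<subseteq> R l"
      using root by auto
    ultimately have "finite S" "card S \<le> card (R l)"
      using fin by (meson inj_on_finite card_inj_on_le)+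
    moreover have "n \<le> n\<^sup>2"
      by (simp add: power2_eq_square)
    ultimately show ?thesis
      using card[of l] by linarith
  qed
qed

theorem corollary3p5:
  fixes f :: "'a::field poly" and n :: nat and c :: "'a octonion"
  assumes "f \<noteq> 0" and "degree f = n" and "n \<ge> 1" and "coeff f 0 = 0"
    and "c \<notin> oct_scalars"
  shows "finite {x. oct_eval f x = c} \<and> card {x. oct_eval f x = c} \<le> n\<^sup>2"
proof -
  obtain l m where tr: "l + m = to_ac (oct_trace c)" and nm: "l * m = to_ac (oct_norm c)"
    using quadratic_roots_exist by blast
  define S where "S = {(r, s). [:-l, 1:] * [:-m, 1:] dvd
    pcompose (map_poly to_ac f) [:r, s:] - [:0, 1:]}"
  have S: "finite S" "card S \<le> n\<^sup>2"
    using card_pairs_pcompose_le[of "map_poly to_ac f" n l m] assms(2,3)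
    by (simp_all add: S_def degree_map_poly)
  \<comment> \<open>These are the pairs with entries in the base field; as \<open>to_ac\<close> is
    injective, there are at most \<open>card S\<close> of them.\<close>
  define P where "P = (\<lambda>(r, s). (to_ac r, to_ac s)) -` S"
  have inj: "inj (\<lambda>(r :: 'a, s :: 'a). (to_ac r, to_ac s))"
    by (auto simp: inj_on_def)
  have "finite P" "card P \<le> n\<^sup>2"
    using S finite_vimageI[OF S(1) inj] card_vimage_inj_on_le[OF inj S(1)] by (auto simp: P_def)
  moreover have "{x. oct_eval f x = c} \<subseteq> (\<lambda>(r, s). oct_plane c r s) ` P"
  proof
    fix x assume "x \<in> {x. oct_eval f x = c}"
    then have x: "oct_eval f x = c" by simp
    then obtain r s where rs: "x = oct_plane c r s"
      using oct_solution_in_plane[of f x] assms(4,5) by auto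
    obtain A B where "oct_eval f x = oct_plane c A B" and
      dvd: "[:-l, 1:] * [:-m, 1:] dvd
        pcompose (map_poly to_ac f) [:to_ac r, to_ac s:] - [:to_ac A, to_ac B:]"
      using oct_eval_plane[OF assms(4) tr nm] rs by blast
    \<comment> \<open>Comparing coordinates of \<open>c\<close> in its own plane turns the remainder
      \<open>A + B z\<close> into \<open>z\<close>, the condition defining \<open>S\<close>.\<close>
    moreover have "c = oct_plane c 0 1"
      by (simp add: oct_plane_def)
    ultimately have "A = 0" "B = 1"
      using oct_plane_inject[OF assms(5)] x by metis+
    with dvd have "(r, s) \<in> P"
      by (simp add: P_def S_def)
    then show "x \<in> (\<lambda>(r, s). oct_plane c r s) ` P"
      using rs by (auto intro: rev_image_eqI)
  qed
  ultimately show ?thesis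
    by (meson card_image_le card_mono dual_order.trans finite_imageI finite_subset)
qed

end
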